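(* Let $\mathcal H$ be a real Hilbert space, $C\subseteq\mathcal H$ nonempty, closed, convex and bounded, and let $B\colon\mathcal H\to\mathcal H$ be monotone and $L$-Lipschitz ($L>0$) with $S\neq\varnothing$. Let $(\beta_k)$ satisfy $0\le\beta_k\le\tfrac14$ and $\sum_k\beta_k<\infty$, set $\theta_k=1-\beta_k$, fix $x_{-1}=x_0=u_0\in C$, let $0<\lambda<(\sqrt2-1)/L$, and define $$x_{k+1}=P_C\bigl(x_k-\lambda B(u_k)\bigr)\quad(k\ge0),\qquad u_k=x_k+\theta_k(x_k-x_{k-1})+\beta_k(x_k-u_{k-1})\quad(k\ge1).$$ Then $(x_k)$ converges weakly to a point of $S$, with $\|x_{k+1}-x_k\|\to0$ and $\|u_k-x_k\|\to0$.
   Context: $P_C$ is the metric projection onto $C$. Monotone means $\langle B(x)-B(y),x-y\rangle\ge0$ for all $x,y\in\mathcal H$; $L$-Lipschitz means $\|B(x)-B(y)\|\le L\|x-y\|$. The solution set is $S=\{z\in C:\langle B(z),x-z\rangle\ge0\ \forall x\in C\}$. *)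

theory Defs
  imports "HOL-Analysis.Analysis"
begin

(* closest_point from HOL-Analysis is restricted to heine_borel spaces, i.e. essentially to
   finite dimension, so the projection is defined here for general inner product spaces.
   The nearest point exists and is unique for C nonempty, closed and convex in a Hilbert space;
   otherwise the value may be unspecified. *)
definition metric_projection :: "'a::real_inner set \<Rightarrow> 'a \<Rightarrow> 'a" where
  "metric_projection C x = (THE p. p \<in> C \<and> (\<forall>y\<in>C. norm (x - p) \<le> norm (x - y)))"

definition monotone_operator :: "('a::real_inner \<Rightarrow> 'a) \<Rightarrow> bool" where
  "monotone_operator B \<longleftrightarrow> (\<forall>x y. inner (B x - B y) (x - y) \<ge> 0)"

definition VI_solutions :: "'a::real_inner set \<Rightarrow> ('a \<Rightarrow> 'a) \<Rightarrow> 'a set" where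
  "VI_solutions C B = {z \<in> C. \<forall>x\<in>C. inner (B z) (x - z) \<ge> 0}"

(* In a Hilbert space the continuous linear functionals are exactly the maps
   v |-> inner v w, so this is convergence in the weak topology. *)
definition weakly_converges_to :: "(nat \<Rightarrow> 'a::real_inner) \<Rightarrow> 'a \<Rightarrow> bool" where
  "weakly_converges_to X z \<longleftrightarrow> (\<forall>w. (\<lambda>n. inner (X n) w) \<longlonglongrightarrow> inner z w)"

end

(* Since theta_k = 1 - beta_k, the recursion reads u_k = 2 x_k - x_{k-1} + e_k with
   e_k = beta_k (x_{k-1} - u_{k-1}): Malitsky's projected reflected gradient method with an error
   that is summable because C is bounded. For a solution z, the energy
     |x_{k+1} - z|^2 + lam L |x_{k+1} - u_k|^2 + 2 lam <B z, x_k - z>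
   decreases up to a multiple of |e_k| by at least a multiple of
   |u_{k+1} - x_{k+1}|^2 + |x_{k+2} - u_{k+1}|^2, so these gaps vanish and the energy converges.
   Weak cluster points are replaced by the intersection of the closed convex hulls of the tails of x:
   it consists of solutions by Minty's lemma. For two of its points z, w the difference of the
   energies converges, which makes <., (w - z) + lam (B z - B w)> constant on the intersection;
   as <B z - B w, z - w> = 0 for solutions, z = w. *)

theory Submission
  imports Defs
begin

section \<open>Projections and nested convex sets in Hilbert space\<close>

text \<open>The parallelogram law, in the form that yields Cauchy sequences: points hardly longer
  than their midpoint are close together.\<close>

lemma norm_diff_sqr_le_of_midpoint:
  fixes a b :: "'a::real_inner"
  assumes "0 \<le> d" "d \<le> norm ((1/2) *\<^sub>R (a + b))" "norm a \<le> c" "norm b \<le> c"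
  shows "(norm (a - b))\<^sup>2 \<le> 4 * (c\<^sup>2 - d\<^sup>2)"
proof -
  define m where "m = norm ((1/2) *\<^sub>R (a + b))"
  have "(norm (a - b))\<^sup>2 = 2 * (norm a)\<^sup>2 + 2 * (norm b)\<^sup>2 - 4 * m\<^sup>2"
    unfolding m_def
    by (simp add: power_divide) (simp add: power2_norm_eq_inner inner_add inner_diff inner_commute)
  moreover have "(norm a)\<^sup>2 \<le> c\<^sup>2" "(norm b)\<^sup>2 \<le> c\<^sup>2" "d\<^sup>2 \<le> m\<^sup>2"
    using assms by (auto intro!: power_mono simp: m_def simp del: norm_scaleR)
  ultimately show ?thesis unfolding right_diff_distrib by linarith
qed

text \<open>Almost norm-minimal points of the sets form a Cauchy sequence by the parallelogram law.\<close>

lemma decseq_closed_convex_bounded_Inter_nonempty: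
  fixes K :: "nat \<Rightarrow> 'a::{real_inner, complete_space} set"
  assumes dec: "decseq K" and cl: "\<And>n. closed (K n)" and cv: "\<And>n. convex (K n)"
    and ne: "\<And>n. K n \<noteq> {}" and bd: "bounded (K 0)"
  shows "(\<Inter>n. K n) \<noteq> {}"
proof -
  define d where "d n = Inf (norm ` K n)" for n
  have bb: "bdd_below (norm ` K n)" for n by (rule bdd_belowI[of _ 0]) auto
  have nei: "norm ` K n \<noteq> {}" for n using ne by simp
  have d_le: "d n \<le> norm v" if "v \<in> K n" for n v
    unfolding d_def using that bb by (auto intro: cInf_lower)
  have d_nonneg: "0 \<le> d n" for n
    unfolding d_def using nei by (intro cInf_greatest) auto
  have sub: "K n \<subseteq> K m" if "m \<le> n" for m n using dec that by (auto dest: decseqD)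
  have "incseq d"
    unfolding incseq_def d_def using nei bb sub by (intro allI impI cInf_superset_mono image_mono)
  obtain R where R: "\<And>v. v \<in> K 0 \<Longrightarrow> norm v \<le> R" using bd by (auto simp: bounded_iff)
  have d_bd: "d n \<le> R" for n
    using ne[of n] d_le R sub[of 0 n] by (meson all_not_in_conv le0 order_trans subsetD)
  then obtain D where D: "d \<longlonglongrightarrow> D" "\<And>n. d n \<le> D"
    using incseq_convergent[OF \<open>incseq d\<close>, of R] by auto
  have "\<exists>v\<in>K n. norm v < d n + inverse (real (Suc n))" for n
  proof -
    have "Inf (norm ` K n) < d n + inverse (real (Suc n))" unfolding d_def by simp
    from cInf_lessD[OF nei this] show ?thesis by auto
  qed
  then obtain p where pK: "\<And>n. p n \<in> K n" and pn: "\<And>n. norm (p n) < d n + inverse (real (Suc n))"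
    by metis
  \<comment> \<open>For \<open>m \<ge> n\<close> both \<open>p m\<close> and \<open>p n\<close> have
    norm at most \<open>D + 1/(n+1)\<close>, and their midpoint lies in the convex set
    \<open>K n\<close>, so it has norm at least \<open>d n\<close>.\<close>
  define g where "g n = 4 * ((D + inverse (real (Suc n)))\<^sup>2 - (d n)\<^sup>2)" for n
  have pp: "(norm (p m - p n))\<^sup>2 \<le> g n" if "n \<le> m" for m n
    unfolding g_def
  proof (rule norm_diff_sqr_le_of_midpoint[OF d_nonneg])
    have "p m \<in> K n" using sub[OF that] pK by blast
    then have "(1/2) *\<^sub>R p m + (1/2) *\<^sub>R p n \<in> K n"
      using cv[of n] pK[of n] by (intro convexD) auto
    then show "d n \<le> norm ((1/2) *\<^sub>R (p m + p n))"
      using d_le by (simp add: scaleR_add_right del: norm_scaleR)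
    have "inverse (real (Suc m)) \<le> inverse (real (Suc n))" using that by (simp add: field_simps)
    then show "norm (p m) \<le> D + inverse (real (Suc n))" using pn[of m] D(2)[of m] by linarith
    show "norm (p n) \<le> D + inverse (real (Suc n))" using pn[of n] D(2)[of n] by linarith
  qed
  have "g \<longlonglongrightarrow> 4 * ((D + 0)\<^sup>2 - D\<^sup>2)"
    unfolding g_def by (intro tendsto_intros D LIMSEQ_inverse_real_of_nat)
  then have g0: "g \<longlonglongrightarrow> 0" by simp
  have "Cauchy p"
  proof (rule CauchyI')
    fix e :: real assume "e > 0"
    then have "eventually (\<lambda>n. g n < e\<^sup>2) sequentially"
      using order_tendstoD(2)[OF g0, of "e\<^sup>2"] by simp
    then obtain N where N: "\<And>n. n \<ge> N \<Longrightarrow> g n < e\<^sup>2" by (auto simp: eventually_sequentially)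
    have "dist (p m) (p n) < e" if "m \<ge> N" "n > m" for m n
    proof -
      have "(dist (p m) (p n))\<^sup>2 < e\<^sup>2"
        using pp[of m n] N[of m] that by (simp add: dist_norm norm_minus_commute)
      then show ?thesis using \<open>e > 0\<close> by (simp add: power_less_imp_less_base)
    qed
    then show "\<exists>M. \<forall>m\<ge>M. \<forall>n>m. dist (p m) (p n) < e" by blast
  qed
  then obtain l where l: "p \<longlonglongrightarrow> l" using Cauchy_convergent_iff convergent_def by blast
  have "l \<in> K n" for n
  proof (rule Lim_in_closed_set[OF cl _ _ l])
    show "eventually (\<lambda>m. p m \<in> K n) sequentially"
      using sub pK by (auto intro!: eventually_sequentiallyI[of n])
  qed simp
  then show ?thesis by blast
qed

text \<open>Intersecting \<open>C\<close> with balls about \<open>a\<close> whose radii shrink to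
  the distance \<open>d\<close> gives nested nonempty bounded closed convex sets. A common point
  attains \<open>d\<close>, so it is the nearest point.\<close>

lemma
  fixes C :: "'a::{real_inner, complete_space} set"
  assumes "C \<noteq> {}" "closed C" "convex C"
  shows metric_projection_in: "metric_projection C a \<in> C"
    and metric_projection_inner: "y \<in> C \<Longrightarrow> inner (metric_projection C a - a) (y - metric_projection C a) \<ge> 0"
proof -
  define d where "d = Inf (dist a ` C)"
  define K where "K n = C \<inter> cball a (d + inverse (real (Suc n)))" for n
  have bb: "bdd_below (dist a ` C)" by (rule bdd_belowI[of _ 0]) auto
  have "(\<Inter>n. K n) \<noteq> {}"
  proof (rule decseq_closed_convex_bounded_Inter_nonempty)
    have "inverse (real (Suc n)) \<le> inverse (real (Suc m))" if "m \<le> n" for m n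
      using that by (simp add: field_simps)
    then show "decseq K"
      unfolding decseq_def K_def by (intro allI impI Int_mono subset_cball order_refl add_left_mono)
    show "closed (K n)" "convex (K n)" for n
      unfolding K_def using assms by (auto intro: closed_Int convex_Int convex_cball)
    show "K n \<noteq> {}" for n
    proof -
      have "Inf (dist a ` C) < d + inverse (real (Suc n))" unfolding d_def by simp
      then obtain v where "v \<in> C" "dist a v < d + inverse (real (Suc n))"
        using assms(1) cInf_lessD[of "dist a ` C"] by auto
      then show ?thesis unfolding K_def by force
    qed
    show "bounded (K 0)" unfolding K_def by (simp add: bounded_Int)
  qed
  then obtain p where p: "\<And>n. p \<in> K n" by blast
  have pC: "p \<in> C" using p[of 0] by (simp add: K_def)
  have "dist a p \<le> d"
  proof (rule LIMSEQ_le_const)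
    show "(\<lambda>n. d + inverse (real (Suc n))) \<longlonglongrightarrow> d"
      using tendsto_add[OF tendsto_const LIMSEQ_inverse_real_of_nat, of d] by simp
    show "\<exists>N. \<forall>n\<ge>N. dist a p \<le> d + inverse (real (Suc n))" using p by (auto simp: K_def)
  qed
  moreover have "d \<le> dist a y" if "y \<in> C" for y
    unfolding d_def using that bb by (auto intro: cInf_lower)
  ultimately have pmin: "norm (a - p) \<le> norm (a - y)" if "y \<in> C" for y
    using that by (force simp: dist_norm)
  have "metric_projection C a = p"
    unfolding metric_projection_def
  proof (rule the_equality)
    show "p \<in> C \<and> (\<forall>y\<in>C. norm (a - p) \<le> norm (a - y))" using pC pmin by blast
    fix q assume q: "q \<in> C \<and> (\<forall>y\<in>C. norm (a - q) \<le> norm (a - y))"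
    show "q = p"
      using any_closest_point_unique[OF assms(3,2), of q p a] q pC pmin by (auto simp: dist_norm)
  qed
  then show "metric_projection C a \<in> C"
    and "y \<in> C \<Longrightarrow> inner (metric_projection C a - a) (y - metric_projection C a) \<ge> 0"
    using pC any_closest_point_dot[OF assms(3,2) pC, of y a] pmin
    by (auto simp: dist_norm inner_diff)
qed

text \<open>Testing at \<open>z + t * (y - z)\<close> and cancelling the factor \<open>t > 0\<close>
  leaves the desired inequality with \<open>B\<close> taken at that point; continuity lets
  \<open>t\<close> tend to 0.\<close>

lemma VI_solutions_Minty:
  fixes B :: "'a::real_inner \<Rightarrow> 'a"
  assumes "convex C" and "continuous_on UNIV B" and "z \<in> C"
    and Minty: "\<And>y. y \<in> C \<Longrightarrow> inner (B y) (y - z) \<ge> 0"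
  shows "z \<in> VI_solutions C B"
proof -
  have "0 \<le> inner (B z) (y - z)" if y: "y \<in> C" for y
  proof (rule LIMSEQ_le_const)
    define t where "t n = inverse (real (Suc n))" for n
    have t0: "t \<longlonglongrightarrow> 0" unfolding t_def by (rule LIMSEQ_inverse_real_of_nat)
    have t: "0 < t n" "t n \<le> 1" for n by (auto simp: t_def field_simps)
    have "(\<lambda>n. z + t n *\<^sub>R (y - z)) \<longlonglongrightarrow> z + 0 *\<^sub>R (y - z)" by (intro tendsto_intros t0)
    then have "(\<lambda>n. B (z + t n *\<^sub>R (y - z))) \<longlonglongrightarrow> B z"
      using assms(2) by (intro continuous_on_tendsto_compose[OF assms(2)]) auto
    then show "(\<lambda>n. inner (B (z + t n *\<^sub>R (y - z))) (y - z)) \<longlonglongrightarrow> inner (B z) (y - z)"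
      by (intro tendsto_intros)
    have "0 \<le> inner (B (z + t n *\<^sub>R (y - z))) (y - z)" for n
    proof -
      have "(1 - t n) *\<^sub>R z + t n *\<^sub>R y \<in> C"
        using assms(1,3) y t[of n] by (intro convexD) auto
      then have "z + t n *\<^sub>R (y - z) \<in> C" by (simp add: algebra_simps)
      from Minty[OF this] t[of n] show ?thesis by (simp add: zero_le_mult_iff)
    qed
    then show "\<exists>N. \<forall>n\<ge>N. 0 \<le> inner (B (z + t n *\<^sub>R (y - z))) (y - z)" by blast
  qed
  then show ?thesis using assms(3) by (auto simp: VI_solutions_def)
qed

section \<open>Hulls of tails and weak convergence\<close>

text \<open>Closed convex sets are weakly closed, so every weak cluster point of \<open>X\<close>
  lies in all of these sets. Their intersection is reached by nested sets instead of
  subsequences.\<close>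

definition tail_hull :: "(nat \<Rightarrow> 'a::real_normed_vector) \<Rightarrow> nat \<Rightarrow> 'a set" where
  "tail_hull X n = closure (convex hull (X ` {n..}))"

lemma tail_hull_in: "n \<le> m \<Longrightarrow> X m \<in> tail_hull X n"
  unfolding tail_hull_def by (meson atLeast_iff closure_subset hull_inc imageI subsetD)

lemma decseq_tail_hull: "decseq (tail_hull X)"
  unfolding decseq_def tail_hull_def
  by (intro allI impI closure_mono hull_mono image_mono) auto

lemma tail_hull_subset:
  "closed S \<Longrightarrow> convex S \<Longrightarrow> (\<And>m. n \<le> m \<Longrightarrow> X m \<in> S) \<Longrightarrow> tail_hull X n \<subseteq> S"
  unfolding tail_hull_def by (intro closure_minimal hull_minimal) auto

text \<open>A closed half-space that contains a tail contains its hull. Only bounds on linear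
  functionals are transferred this way, so other inequalities must first be brought to that
  form.\<close>

lemma tail_hull_Inter_inner_ge:
  assumes "q \<in> (\<Inter>n. tail_hull X n)" and "\<And>e. 0 < e \<Longrightarrow> \<forall>\<^sub>F n in sequentially. b - e \<le> inner w (X n)"
  shows "b \<le> inner w q"
proof (rule field_le_epsilon)
  fix e :: real assume "0 < e"
  then obtain N where N: "\<And>n. n \<ge> N \<Longrightarrow> b - e \<le> inner w (X n)"
    using assms(2) by (auto simp: eventually_sequentially)
  have "tail_hull X N \<subseteq> {v. inner w v \<ge> b - e}"
    by (rule tail_hull_subset) (use N in \<open>auto intro: closed_halfspace_ge convex_halfspace_ge\<close>)
  then show "b \<le> inner w q + e" using assms(1) by force
qed

text \<open>The lower bound is applied to \<open>w\<close> and to \<open>- w\<close>. Hence a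
  functional that converges along \<open>X\<close> cannot separate points of the
  intersection.\<close>

lemma tail_hull_Inter_inner_eq:
  assumes "q \<in> (\<Inter>n. tail_hull X n)" and "(\<lambda>n. inner w (X n)) \<longlonglongrightarrow> b"
  shows "inner w q = b"
proof (rule antisym)
  show "b \<le> inner w q"
  proof (rule tail_hull_Inter_inner_ge[OF assms(1)])
    fix e :: real assume "0 < e"
    then show "\<forall>\<^sub>F n in sequentially. b - e \<le> inner w (X n)"
      using order_tendstoD(1)[OF assms(2), of "b - e"] by (auto elim: eventually_mono)
  qed
  have "- b \<le> inner (- w) q"
  proof (rule tail_hull_Inter_inner_ge[OF assms(1)])
    fix e :: real assume "0 < e"
    then show "\<forall>\<^sub>F n in sequentially. - b - e \<le> inner (- w) (X n)"
      using order_tendstoD(2)[OF assms(2), of "b + e"] by (auto elim: eventually_mono)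
  qed
  then show "inner w q \<le> b" by simp
qed

lemma bounded_tail_hull: "bounded (range X) \<Longrightarrow> bounded (tail_hull X n)"
  unfolding tail_hull_def
  by (intro bounded_closure bounded_convex_hull) (auto intro: bounded_subset)

lemma tail_hull_Inter_nonempty:
  fixes X :: "nat \<Rightarrow> 'a::{real_inner, complete_space}"
  assumes "bounded (range X)"
  shows "(\<Inter>n. tail_hull X n) \<noteq> {}"
proof (rule decseq_closed_convex_bounded_Inter_nonempty[OF decseq_tail_hull])
  show "closed (tail_hull X n)" "convex (tail_hull X n)" for n
    by (auto simp: tail_hull_def convex_closure)
  show "tail_hull X n \<noteq> {}" for n using tail_hull_in[of n n X] by blast
qed (rule bounded_tail_hull[OF assms])

text \<open>If \<open>inner w (X m) \<ge> b > inner w q\<close> for infinitely many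
  \<open>m\<close>, this half-space meets every tail hull. The nested sets then have a common point,
  which lies in the intersection but is not \<open>q\<close>.\<close>

lemma weakly_converges_to_tail_hull_Inter:
  fixes X :: "nat \<Rightarrow> 'a::{real_inner, complete_space}"
  assumes bd: "bounded (range X)" and sing: "(\<Inter>n. tail_hull X n) \<subseteq> {q}"
  shows "weakly_converges_to X q"
proof -
  have ev: "\<forall>\<^sub>F n in sequentially. inner w (X n) < b" if b: "inner w q < b" for w b
  proof (rule ccontr)
    assume "\<not> ?thesis"
    then have fr: "\<exists>m\<ge>n. b \<le> inner w (X m)" for n
      by (auto simp: eventually_sequentially not_less)
    define K where "K n = tail_hull X n \<inter> {v. inner w v \<ge> b}" for n
    have "(\<Inter>n. K n) \<noteq> {}"
    proof (rule decseq_closed_convex_bounded_Inter_nonempty)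
      show "decseq K" using decseq_tail_hull[of X] unfolding K_def decseq_def by blast
      show "closed (K n)" "convex (K n)" for n
        unfolding K_def tail_hull_def
        by (auto intro!: closed_Int convex_Int closed_halfspace_ge convex_halfspace_ge convex_closure)
      show "K n \<noteq> {}" for n using fr[of n] tail_hull_in[of n _ X] unfolding K_def by blast
      show "bounded (K 0)" unfolding K_def using bounded_tail_hull[OF bd] by (simp add: bounded_Int)
    qed
    then obtain v where "\<And>n. v \<in> K n" by blast
    then show False using sing b unfolding K_def by force
  qed
  have "(\<lambda>n. inner w (X n)) \<longlonglongrightarrow> inner w q" for w
  proof (rule order_tendstoI)
    fix b assume "inner w q < b" then show "\<forall>\<^sub>F n in sequentially. inner w (X n) < b" by (rule ev)
  next
    fix b assume "b < inner w q"
    then show "\<forall>\<^sub>F n in sequentially. b < inner w (X n)" using ev[of "- w" "- b"] by simp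
  qed
  then show ?thesis by (simp add: weakly_converges_to_def inner_commute)
qed

lemma tendsto_inner_null_Bseq:
  fixes f g :: "nat \<Rightarrow> 'a::real_inner"
  assumes "f \<longlonglongrightarrow> 0" and "Bseq g"
  shows "(\<lambda>n. inner (f n) (g n)) \<longlonglongrightarrow> 0"
proof -
  have "Zfun f sequentially" using assms(1) by (simp add: tendsto_Zfun_iff)
  from bounded_bilinear.Zfun_prod_Bfun[OF bounded_bilinear_inner this assms(2)]
  show ?thesis by (simp add: tendsto_Zfun_iff)
qed

section \<open>The energy inequality\<close>

text \<open>Subtracting the partial sums of \<open>\<epsilon>\<close> makes \<open>a\<close>
  decreasing and keeps it bounded below; telescoping \<open>step\<close> bounds the partial sums of
  \<open>b\<close>.\<close>

lemma quasi_decreasing: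
  fixes a b \<epsilon> :: "nat \<Rightarrow> real"
  assumes a: "\<And>n. 0 \<le> a n" and b: "\<And>n. 0 \<le> b n"
    and \<epsilon>: "\<And>n. 0 \<le> \<epsilon> n" "summable \<epsilon>"
    and step: "\<And>n. a (Suc n) + b n \<le> a n + \<epsilon> n"
  shows "convergent a" and "summable b"
proof -
  have bd: "(\<Sum>i<n. \<epsilon> i) \<le> suminf \<epsilon>" for n using \<epsilon> by (intro sum_le_suminf) auto
  define c where "c n = a n - (\<Sum>i<n. \<epsilon> i)" for n
  have "c (Suc n) \<le> c n" for n using step[of n] b[of n] by (simp add: c_def)
  then have "decseq c" by (rule decseq_SucI)
  moreover have "- suminf \<epsilon> \<le> c n" for n using bd[of n] a[of n] by (simp add: c_def)
  ultimately obtain l where "c \<longlonglongrightarrow> l" using decseq_convergent by metis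
  then have "(\<lambda>n. c n + (\<Sum>i<n. \<epsilon> i)) \<longlonglongrightarrow> l + suminf \<epsilon>"
    by (intro tendsto_add summable_LIMSEQ \<epsilon>)
  then show "convergent a" by (auto simp: c_def convergent_def)
  have "(\<Sum>i<n. b i) + a n \<le> a 0 + (\<Sum>i<n. \<epsilon> i)" for n
  proof (induction n)
    case (Suc n)
    then show ?case using step[of n] by simp
  qed simp
  then have "(\<Sum>i<n. b i) \<le> a 0 + suminf \<epsilon>" for n
    using bd[of n] a[of n] by (meson add_left_mono add_increasing2 dual_order.trans order_refl)
  then show "summable b" using b by (intro summableI_nonneg_bounded) auto
qed

text \<open>The weights are fitted to the energy: the term in \<open>t\<close> is exactly the one
  stored there, and once the new energy has taken one more \<open>b\<^sup>2\<close>, both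
  \<open>s\<^sup>2\<close> and \<open>b\<^sup>2\<close> carry the factor
  \<open>1 + sqrt 2\<close>.\<close>

lemma sqrt2_Young:
  fixes s t b :: real
  shows "2 * (s + t) * b \<le> (1 + sqrt 2) * s\<^sup>2 + t\<^sup>2 + sqrt 2 * b\<^sup>2"
proof -
  define w where "w = sqrt 2"
  have w: "w * w = 2" "0 \<le> w" "w \<le> 2" by (auto simp: w_def real_sqrt_le_iff intro: real_le_lsqrt)
  have ww: "w * (w * y) = 2 * y" for y using w(1) by (simp flip: mult.assoc)
  \<comment> \<open>The difference of the two sides as a weighted sum of squares;
    \<open>w * w = 2\<close> cancels the mixed term in \<open>s * t\<close>.\<close>
  have "0 \<le> (w/2) * (s + t - w * b)\<^sup>2 + (1 - w/2) * ((1 + w) * s - t)\<^sup>2"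
    using w by (intro add_nonneg_nonneg mult_nonneg_nonneg) auto
  also have "\<dots> = (1 + w) * s\<^sup>2 + t\<^sup>2 + w * b\<^sup>2 - 2 * (s + t) * b"
    using w(1) by (simp add: power2_eq_square algebra_simps ww)
  finally show ?thesis by (simp add: w_def)
qed

text \<open>With \<open>p, q, r\<close> consecutive iterates, the reflected point \<open>2 q - p\<close> is the one at which the
  variational inequality for \<open>q\<close> can be tested against \<open>r\<close> and \<open>p\<close> simultaneously.\<close>

lemma energy_step:
  fixes p q r u v e z Bu Bv Bz :: "'a::real_inner"
  assumes v: "v = 2 *\<^sub>R q - p + e"
    and rz: "inner (r - (q - \<gamma> *\<^sub>R Bv)) (z - r) \<ge> 0"
    and qr: "inner (q - (p - \<gamma> *\<^sub>R Bu)) (r - q) \<ge> 0"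
    and qp: "inner (q - (p - \<gamma> *\<^sub>R Bu)) (p - q) \<ge> 0"
    and mono: "inner (Bv - Bz) (v - z) \<ge> 0"
    and lip: "norm (Bv - Bu) \<le> L * norm (v - u)"
    and pos: "0 \<le> L" "0 \<le> \<gamma>"
  shows "(norm (r - z))\<^sup>2 + \<gamma> * L * (norm (r - v))\<^sup>2 + 4 * \<gamma> * inner Bz (q - z)
      + (1 - \<gamma> * L * (1 + sqrt 2)) * ((norm (v - q))\<^sup>2 + (norm (r - v))\<^sup>2)
    \<le> (norm (q - z))\<^sup>2 + \<gamma> * L * (norm (q - u))\<^sup>2 + 2 * \<gamma> * inner Bz (p - z)
      + 2 * inner e (\<gamma> *\<^sub>R (Bu - Bz) + (v - q) - (r - v) - e)"
proof -
  \<comment> \<open>This is the price of exchanging \<open>Bv\<close> for \<open>Bu\<close>. Passing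
    through \<open>q\<close> splits \<open>norm (v - u)\<close> into the current gap and the gap
    \<open>norm (q - u)\<close> stored in the old energy.\<close>
  have "inner (Bv - Bu) (v - r) \<le> norm (Bv - Bu) * norm (v - r)" by (rule norm_cauchy_schwarz)
  also have "\<dots> \<le> L * (norm (v - q) + norm (q - u)) * norm (r - v)"
    using norm_triangle_ineq[of "v - q" "q - u"] lip pos
    by (intro mult_mono) (auto simp: norm_minus_commute intro: order_trans mult_left_mono)
  finally have "2 * \<gamma> * inner (Bv - Bu) (v - r) \<le> 2 * \<gamma> * \<dots>"
    using pos by (intro mult_left_mono) auto
  also have "\<dots> = \<gamma> * L * (2 * (norm (v - q) + norm (q - u)) * norm (r - v))" by simp
  also have "\<dots> \<le> \<gamma> * L * ((1 + sqrt 2) * (norm (v - q))\<^sup>2 + (norm (q - u))\<^sup>2 + sqrt 2 * (norm (r - v))\<^sup>2)"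
    using pos by (intro mult_left_mono sqrt2_Young) auto
  finally have cross: "2 * \<gamma> * inner (Bv - Bu) (v - r) \<le> \<dots>" .
  have mono': "\<gamma> * inner (Bv - Bz) (v - z) \<ge> 0" using mono pos by simp
  \<comment> \<open>Adding \<open>qr\<close> and \<open>qp\<close> tests against
    \<open>r + p - 2 q = r - v + e\<close>, where \<open>q - p = v - q - e\<close>. The expansion of
    \<open>2 * inner (v - q) (r - v)\<close> trades the squared norm of \<open>r - q\<close> coming
    from \<open>rz\<close> for the two gaps, and \<open>v = 2 q - p + e\<close> splits
    \<open>inner Bz (v - z)\<close> into the terms at \<open>q\<close> and \<open>p\<close>.\<close>
  have main: "(norm (r - z))\<^sup>2 + (norm (v - q))\<^sup>2 + (norm (r - v))\<^sup>2 + 4 * \<gamma> * inner Bz (q - z)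
    \<le> (norm (q - z))\<^sup>2 + 2 * \<gamma> * inner Bz (p - z) + 2 * \<gamma> * inner (Bv - Bu) (v - r)
      + 2 * inner e (\<gamma> *\<^sub>R (Bu - Bz) + (v - q) - (r - v) - e)"
    using rz qr qp mono' unfolding v
    by (simp add: power2_norm_eq_inner inner_add inner_diff inner_commute algebra_simps)
  from main cross show ?thesis by (simp add: algebra_simps)
qed

section \<open>The reflected iteration with summable errors\<close>

locale perturbed_reflected_gradient =
  fixes C :: "'a::{real_inner, complete_space} set" and B :: "'a \<Rightarrow> 'a" and L \<gamma> :: real
    and X u e :: "nat \<Rightarrow> 'a"
  assumes C: "closed C" "convex C" "bounded C"
    and mono: "monotone_operator B"
    and L_pos: "0 < L" and lip: "L-lipschitz_on UNIV B"
    and sol: "VI_solutions C B \<noteq> {}"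
    and \<gamma>_pos: "0 < \<gamma>" and \<gamma>_less: "\<gamma> < (sqrt 2 - 1) / L"
    and e: "summable (\<lambda>n. norm (e n))"
    and X0: "X 0 \<in> C"
    and X_Suc: "\<And>n. X (Suc n) = metric_projection C (X n - \<gamma> *\<^sub>R B (u n))"
    and u_Suc: "\<And>n. u (Suc n) = 2 *\<^sub>R X (Suc n) - X n + e n"
begin

lemma monoD: "inner (B x - B y) (x - y) \<ge> 0"
  using mono by (simp add: monotone_operator_def)

lemma lipD: "norm (B x - B y) \<le> L * norm (x - y)"
  using lipschitz_onD[OF lip, of x y] by (simp add: dist_norm)

lemma C_nonempty: "C \<noteq> {}" using X0 by blast

lemma X_in: "X n \<in> C"
  by (cases n) (use X0 X_Suc metric_projection_in[OF C_nonempty C(1,2)] in auto)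

lemma X_inner: "y \<in> C \<Longrightarrow> inner (X (Suc n) - (X n - \<gamma> *\<^sub>R B (u n))) (y - X (Suc n)) \<ge> 0"
  unfolding X_Suc by (rule metric_projection_inner[OF C_nonempty C(1,2)])

lemma X_Bseq: "Bseq X"
  using C(3) X_in by (auto simp: Bseq_eq_bounded intro: bounded_subset)

lemma e_Bseq: "Bseq e"
  using summable_LIMSEQ_zero[OF e] tendsto_norm_zero_cancel convergent_imp_Bseq convergentI by blast

lemma u_Bseq: "Bseq u"
proof (subst Bseq_Suc_iff[symmetric], subst u_Suc)
  have "Bseq (\<lambda>n. X (Suc n))" using X_Bseq by (simp add: Bseq_Suc_iff)
  moreover note e_Bseq
  ultimately show "Bseq (\<lambda>n. 2 *\<^sub>R X (Suc n) - X n + e n)"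
    using X_Bseq unfolding Bseq_eq_bounded
    by (intro bounded_plus_comp bounded_minus_comp bounded_scaleR_comp) auto
qed

lemma B_u_Bseq: "Bseq (\<lambda>n. B (u n))"
proof -
  obtain M where M: "\<And>n. norm (u n - 0) \<le> M" using u_Bseq by (auto simp: Bseq_def)
  have "norm (B (u n) - B 0) \<le> L * M" for n
    using lipD[of "u n" 0] M[of n] L_pos by (meson mult_left_mono less_imp_le order_trans)
  then have "Bseq (\<lambda>n. B (u n) - B 0)" by (rule BseqI')
  from Bseq_add[OF this, of "B 0"] show ?thesis by simp
qed

text \<open>The linear term lags one index behind the others. For a solution \<open>z\<close> it is
  nonnegative because the iterates stay in \<open>C\<close>.\<close>

definition energy :: "'a \<Rightarrow> nat \<Rightarrow> real" where
  "energy z n = (norm (X (Suc n) - z))\<^sup>2 + \<gamma> * L * (norm (X (Suc n) - u n))\<^sup>2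
     + 2 * \<gamma> * inner (B z) (X n - z)"

text \<open>The step size bound enters through
  \<open>(sqrt 2 - 1) * (1 + sqrt 2) = 1\<close>.\<close>

lemma \<gamma>L: "0 < 1 - \<gamma> * L * (1 + sqrt 2)"
proof -
  have "\<gamma> * L < sqrt 2 - 1" using \<gamma>_less L_pos by (simp add: field_simps)
  then have "\<gamma> * L * (1 + sqrt 2) < (sqrt 2 - 1) * (1 + sqrt 2)"
    by (intro mult_strict_right_mono) (auto intro: add_pos_pos)
  then show ?thesis by (simp add: algebra_simps)
qed

lemma
  assumes z: "z \<in> VI_solutions C B"
  shows convergent_energy: "convergent (energy z)"
    and summable_gaps:
      "summable (\<lambda>n. (norm (u (Suc n) - X (Suc n)))\<^sup>2 + (norm (X (Suc (Suc n)) - u (Suc n)))\<^sup>2)"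
proof -
  have zC: "z \<in> C" and zge: "\<And>y. y \<in> C \<Longrightarrow> 0 \<le> inner (B z) (y - z)"
    using z by (auto simp: VI_solutions_def)
  define \<kappa> where "\<kappa> = 1 - \<gamma> * L * (1 + sqrt 2)"
  \<comment> \<open>The vector paired with the error \<open>e n\<close> in the energy inequality.
    Its boundedness makes that contribution summable.\<close>
  define f where "f n = \<gamma> *\<^sub>R (B (u n) - B z) + (u (Suc n) - X (Suc n))
    - (X (Suc (Suc n)) - u (Suc n)) - e n" for n
  define g where "g n = (norm (u (Suc n) - X (Suc n)))\<^sup>2 + (norm (X (Suc (Suc n)) - u (Suc n)))\<^sup>2" for n
  have "Bseq (\<lambda>n. X (Suc n))" "Bseq (\<lambda>n. X (Suc (Suc n)))" "Bseq (\<lambda>n. u (Suc n))"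
    using X_Bseq u_Bseq by (simp_all add: Bseq_Suc_iff[of "\<lambda>n. X (Suc n)"] Bseq_Suc_iff)
  with B_u_Bseq e_Bseq have "Bseq f"
    unfolding Bseq_eq_bounded f_def
    by (intro bounded_plus_comp bounded_minus_comp bounded_scaleR_comp) auto
  then obtain K where K: "0 < K" "\<And>n. norm (f n) \<le> K" by (auto elim: BseqE)
  have step: "energy z (Suc n) + \<kappa> * g n \<le> energy z n + 2 * K * norm (e n)" for n
  proof -
    have "inner (e n) (f n) \<le> norm (e n) * K"
      using norm_cauchy_schwarz[of "e n" "f n"] K by (meson mult_left_mono norm_ge_zero order_trans)
    \<comment> \<open>The energy inequality has factor \<open>4 * \<gamma>\<close> at
      \<open>X (Suc n)\<close>: half of it is the linear term of the new energy, and the other half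
      is dropped by this sign.\<close>
    moreover have "0 \<le> \<gamma> * inner (B z) (X (Suc n) - z)" using zge X_in \<gamma>_pos by simp
    moreover have "(norm (X (Suc (Suc n)) - z))\<^sup>2 + \<gamma> * L * (norm (X (Suc (Suc n)) - u (Suc n)))\<^sup>2
        + 4 * \<gamma> * inner (B z) (X (Suc n) - z) + \<kappa> * g n
      \<le> (norm (X (Suc n) - z))\<^sup>2 + \<gamma> * L * (norm (X (Suc n) - u n))\<^sup>2
        + 2 * \<gamma> * inner (B z) (X n - z) + 2 * inner (e n) (f n)"
      unfolding \<kappa>_def g_def f_def using L_pos \<gamma>_pos
      by (intro energy_step[OF u_Suc X_inner[OF zC] X_inner[OF X_in] X_inner[OF X_in] monoD lipD]) auto
    ultimately show ?thesis unfolding energy_def by (simp add: algebra_simps)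
  qed
  have "0 \<le> energy z n" for n
    using zge X_in \<gamma>_pos L_pos by (simp add: energy_def)
  moreover have "0 \<le> \<kappa> * g n" for n using \<gamma>L by (simp add: \<kappa>_def g_def)
  moreover have "summable (\<lambda>n. 2 * K * norm (e n))" using e by (rule summable_mult)
  ultimately have "convergent (energy z)" "summable (\<lambda>n. \<kappa> * g n)"
    using quasi_decreasing[of "energy z" "\<lambda>n. \<kappa> * g n" "\<lambda>n. 2 * K * norm (e n)"] step K(1) by auto
  moreover have "\<kappa> \<noteq> 0" using \<gamma>L by (simp add: \<kappa>_def)
  ultimately show "convergent (energy z)"
    and "summable (\<lambda>n. (norm (u (Suc n) - X (Suc n)))\<^sup>2 + (norm (X (Suc (Suc n)) - u (Suc n)))\<^sup>2)"
    by (auto simp: g_def[abs_def])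
qed

section \<open>Vanishing gaps and the weak limit\<close>

lemma u_minus_X_null: "(\<lambda>n. u n - X n) \<longlonglongrightarrow> 0"
  and X_Suc_minus_u_null: "(\<lambda>n. X (Suc n) - u n) \<longlonglongrightarrow> 0"
proof -
  obtain z where "z \<in> VI_solutions C B" using sol by blast
  note sm = summable_gaps[OF this]
  have "summable (\<lambda>n. (norm (u (Suc n) - X (Suc n)))\<^sup>2)"
    by (rule summable_comparison_test'[OF sm, of 0]) simp
  from summable_LIMSEQ_zero[OF this] have "(\<lambda>n. u (Suc n) - X (Suc n)) \<longlonglongrightarrow> 0"
    by (simp add: power_tendsto_0_iff tendsto_norm_zero_iff)
  then show "(\<lambda>n. u n - X n) \<longlonglongrightarrow> 0" by (rule LIMSEQ_imp_Suc)
  have "summable (\<lambda>n. (norm (X (Suc (Suc n)) - u (Suc n)))\<^sup>2)"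
    by (rule summable_comparison_test'[OF sm, of 0]) simp
  from summable_LIMSEQ_zero[OF this] have "(\<lambda>n. X (Suc (Suc n)) - u (Suc n)) \<longlonglongrightarrow> 0"
    by (simp add: power_tendsto_0_iff tendsto_norm_zero_iff)
  then show "(\<lambda>n. X (Suc n) - u n) \<longlonglongrightarrow> 0" by (rule LIMSEQ_imp_Suc)
qed

lemma X_diff_null: "(\<lambda>n. X (Suc n) - X n) \<longlonglongrightarrow> 0"
  using tendsto_add[OF u_minus_X_null X_Suc_minus_u_null] by simp

text \<open>Monotonicity replaces \<open>B (u n)\<close> by the fixed vector \<open>B y\<close> in
  the projection inequality. Up to a null sequence this is an affine bound on \<open>X n\<close>,
  which passes to the intersection and becomes the hypothesis of Minty's lemma.\<close>

lemma tail_hull_Inter_subset_solutions: "(\<Inter>n. tail_hull X n) \<subseteq> VI_solutions C B"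
proof
  fix q assume q: "q \<in> (\<Inter>n. tail_hull X n)"
  have "tail_hull X 0 \<subseteq> C" using C X_in by (intro tail_hull_subset) auto
  with q have qC: "q \<in> C" by blast
  have "continuous_on UNIV B" using lip by (rule lipschitz_on_continuous_on)
  then show "q \<in> VI_solutions C B"
  proof (rule VI_solutions_Minty[OF C(2) _ qC])
    fix y assume y: "y \<in> C"
    have yX: "Bseq (\<lambda>n. y - X (Suc n))"
      using Bseq_ignore_initial_segment[OF X_Bseq, of 1] unfolding Bseq_eq_bounded
      by (intro bounded_minus_comp) auto
    \<comment> \<open>Collects everything that contains a vanishing gap as a factor; the other
      factors are bounded.\<close>
    define r where "r n = inner (X (Suc n) - X n) (y - X (Suc n)) + \<gamma> * inner (u n - X (Suc n)) (B (u n))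
       + \<gamma> * inner (B y) (X n - u n)" for n
    have r0: "r \<longlonglongrightarrow> 0"
    proof -
      have null: "(\<lambda>n. u n - X (Suc n)) \<longlonglongrightarrow> 0" "(\<lambda>n. X n - u n) \<longlonglongrightarrow> 0"
        using tendsto_minus[OF X_Suc_minus_u_null] tendsto_minus[OF u_minus_X_null] by simp_all
      have "r \<longlonglongrightarrow> 0 + \<gamma> * 0 + \<gamma> * inner (B y) 0"
        unfolding r_def
        by (intro tendsto_intros tendsto_inner_null_Bseq X_diff_null yX B_u_Bseq null)
      then show ?thesis by simp
    qed
    have ineq: "\<gamma> * inner (B y) (y - X n) + r n \<ge> 0" for n
    proof -
      have "\<gamma> * inner (B y - B (u n)) (y - u n) \<ge> 0" using monoD \<gamma>_pos by simp
      with X_inner[OF y, of n] show ?thesis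
        unfolding r_def by (simp add: inner_add inner_diff inner_commute algebra_simps)
    qed
    have "inner (\<gamma> *\<^sub>R - B y) q \<ge> - \<gamma> * inner (B y) y"
    proof (rule tail_hull_Inter_inner_ge[OF q])
      fix d :: real assume "0 < d"
      then have "\<forall>\<^sub>F n in sequentially. r n < d" using order_tendstoD(2)[OF r0] by blast
      then show "\<forall>\<^sub>F n in sequentially. - \<gamma> * inner (B y) y - d \<le> inner (\<gamma> *\<^sub>R - B y) (X n)"
      proof eventually_elim
        case (elim n)
        then show ?case using ineq[of n] by (simp add: inner_diff algebra_simps)
      qed
    qed
    then have "\<gamma> * inner (B y) (y - q) \<ge> 0" by (simp add: inner_diff algebra_simps)
    then show "inner (B y) (y - q) \<ge> 0" using \<gamma>_pos by (simp add: zero_le_mult_iff)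
  qed
qed

lemma tail_hull_Inter_unique:
  assumes z: "z \<in> (\<Inter>n. tail_hull X n)" and w: "w \<in> (\<Inter>n. tail_hull X n)"
  shows "z = w"
proof -
  have zS: "z \<in> VI_solutions C B" and wS: "w \<in> VI_solutions C B"
    using tail_hull_Inter_subset_solutions z w by auto
  have Bzw: "inner (B z - B w) (z - w) = 0"
  proof (rule antisym)
    have "inner (B z) (w - z) \<ge> 0" "inner (B w) (z - w) \<ge> 0"
      using zS wS by (auto simp: VI_solutions_def)
    then show "inner (B z - B w) (z - w) \<le> 0" by (simp add: inner_diff)
  qed (rule monoD)
  \<comment> \<open>In the difference of the energies of \<open>z\<close> and \<open>w\<close> the
    squares of the iterates and the gap terms cancel; \<open>h\<close> is the coefficient of
    \<open>X n\<close> in what remains, after \<open>X (Suc n)\<close> is replaced by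
    \<open>X n\<close> at the cost of a null sequence.\<close>
  define h where "h = 2 *\<^sub>R (w - z) + (2 * \<gamma>) *\<^sub>R (B z - B w)"
  have "convergent (\<lambda>n. inner h (X n))"
  proof -
    obtain a where a: "(\<lambda>n. energy z n - energy w n) \<longlonglongrightarrow> a"
      using convergent_diff[OF convergent_energy[OF zS] convergent_energy[OF wS]]
      by (auto simp: convergent_def)
    define c where "c = inner z z - inner w w - 2 * \<gamma> * (inner (B z) z - inner (B w) w)"
    have "(\<lambda>n. (energy z n - energy w n) - 2 * inner (w - z) (X (Suc n) - X n) - c)
        \<longlonglongrightarrow> a - 2 * inner (w - z) 0 - c"
      by (intro tendsto_intros a X_diff_null)
    moreover have "(energy z n - energy w n) - 2 * inner (w - z) (X (Suc n) - X n) - c = inner h (X n)" for n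
      unfolding energy_def c_def h_def
      by (simp add: power2_norm_eq_inner inner_add inner_diff inner_commute algebra_simps)
    ultimately show ?thesis by (auto simp: convergent_def)
  qed
  then obtain b where "(\<lambda>n. inner h (X n)) \<longlonglongrightarrow> b" by (auto simp: convergent_def)
  from tail_hull_Inter_inner_eq[OF z this] tail_hull_Inter_inner_eq[OF w this]
  have "inner h (z - w) = 0" by (simp add: inner_diff)
  moreover have "inner h (z - w) = 2 * \<gamma> * inner (B z - B w) (z - w) - 2 * inner (z - w) (z - w)"
    unfolding h_def by (simp add: inner_add inner_diff inner_commute algebra_simps)
  ultimately show ?thesis using Bzw by simp
qed

theorem weakly_converges: "\<exists>z\<in>VI_solutions C B. weakly_converges_to X z"
proof -
  have bd: "bounded (range X)" using X_Bseq by (simp add: Bseq_eq_bounded)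
  then obtain z where z: "z \<in> (\<Inter>n. tail_hull X n)" using tail_hull_Inter_nonempty by blast
  then have "(\<Inter>n. tail_hull X n) \<subseteq> {z}" using tail_hull_Inter_unique by blast
  then show ?thesis
    using weakly_converges_to_tail_hull_Inter[OF bd] tail_hull_Inter_subset_solutions z by blast
qed

end

section \<open>Reduction of the stated recursion to the perturbed one\<close>

theorem corollary5p4:
  fixes C :: "'a::{real_inner, complete_space} set"
    and B :: "'a \<Rightarrow> 'a"
    and L lam :: real
    and \<beta> \<theta> :: "nat \<Rightarrow> real"
    and x :: "int \<Rightarrow> 'a"
    and u :: "nat \<Rightarrow> 'a"
  assumes "C \<noteq> {}" and "closed C" and "convex C" and "bounded C"
    and "monotone_operator B"
    and "L > 0" and "L-lipschitz_on UNIV B"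
    and "VI_solutions C B \<noteq> {}"
    and "\<And>k. 0 \<le> \<beta> k" and "\<And>k. \<beta> k \<le> 1/4" and "summable \<beta>"
    and "\<And>k. \<theta> k = 1 - \<beta> k"
    and "x (-1) = x 0" and "x 0 = u 0" and "u 0 \<in> C"
    and "0 < lam" and "lam < (sqrt 2 - 1) / L"
    and "\<And>k::nat. x (int k + 1) = metric_projection C (x (int k) - lam *\<^sub>R B (u k))"
    and "\<And>k::nat. k \<ge> 1 \<Longrightarrow>
           u k = x (int k) + \<theta> k *\<^sub>R (x (int k) - x (int k - 1))
                 + \<beta> k *\<^sub>R (x (int k) - u (k - 1))"
  shows "(\<exists>z \<in> VI_solutions C B. weakly_converges_to (\<lambda>k. x (int k)) z)
    \<and> (\<lambda>k. norm (x (int k + 1) - x (int k))) \<longlonglongrightarrow> 0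
    \<and> (\<lambda>k. norm (u k - x (int k))) \<longlonglongrightarrow> 0"
proof -
  define X where "X n = x (int n)" for n
  \<comment> \<open>With \<open>\<theta> = 1 - \<beta>\<close> the terms in \<open>\<beta>\<close>
    combine to this vector. The index of \<open>\<beta>\<close> is \<open>Suc n\<close> since
    \<open>e n\<close> enters \<open>u (Suc n)\<close>.\<close>
  define e where "e n = \<beta> (Suc n) *\<^sub>R (X n - u n)" for n
  have X_Suc: "X (Suc n) = metric_projection C (X n - lam *\<^sub>R B (u n))" for n
    using assms(18)[of n] by (simp add: X_def add.commute)
  have u_Suc: "u (Suc n) = 2 *\<^sub>R X (Suc n) - X n + e n" for n
    using assms(19)[of "Suc n"] unfolding X_def e_def assms(12)
    by (simp add: algebra_simps scaleR_2)
  have X_in: "X n \<in> C" for n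
    by (cases n) (use assms(14,15) metric_projection_in[OF assms(1-3)] X_Suc in \<open>auto simp: X_def\<close>)
  obtain R where R: "\<And>v. v \<in> C \<Longrightarrow> norm v \<le> R" using assms(4) by (auto simp: bounded_iff)
  have R0: "0 \<le> R" using R[OF assms(15)] norm_ge_zero order_trans by blast
  \<comment> \<open>The bound \<open>4 * R\<close> reproduces itself: two iterates contribute at
    most \<open>2 * R\<close>, and \<open>\<beta> \<le> 1/4\<close> reduces the previous gap to
    \<open>R\<close>, in total \<open>3 * R\<close>. Summability of the errors rests on this
    bound.\<close>
  have uX: "norm (X n - u n) \<le> 4 * R" for n
  proof (induction n)
    case 0
    then show ?case using assms(14) R0 by (simp add: X_def)
  next
    case (Suc n)
    have "norm (X (Suc n) - u (Suc n)) \<le> norm (X n) + norm (X (Suc n)) + norm (e n)"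
      unfolding u_Suc
      using norm_triangle_ineq4[of "X n - X (Suc n)" "e n"] norm_triangle_ineq4[of "X n" "X (Suc n)"]
      by (simp add: algebra_simps scaleR_2)
    moreover have "norm (e n) \<le> 1/4 * (4 * R)"
      unfolding e_def norm_scaleR using assms(9,10) Suc by (intro mult_mono) auto
    ultimately show ?case using R[OF X_in[of n]] R[OF X_in[of "Suc n"]] R0 by linarith
  qed
  have "summable (\<lambda>n. norm (e n))"
  proof (rule summable_comparison_test')
    show "summable (\<lambda>n. \<beta> (Suc n) * (4 * R))"
      using assms(11) by (intro summable_mult2) (simp add: summable_Suc_iff)
    show "norm (norm (e n)) \<le> \<beta> (Suc n) * (4 * R)" for n
      using uX[of n] assms(9) by (simp add: e_def mult_left_mono)
  qed
  then interpret perturbed_reflected_gradient C B L lam X u e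
    using assms X_Suc u_Suc X_in by unfold_locales auto
  show ?thesis
    using weakly_converges tendsto_norm_zero[OF X_diff_null] tendsto_norm_zero[OF u_minus_X_null]
    by (simp add: X_def[abs_def] add.commute)
qed

end
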